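(* Let $A$ be an $n\times n$ complex matrix, $X$ an $n\times p$ complex matrix, $Y$ an $n\times q$ complex matrix, and let $$M = A^{\dagger} - A^{\dagger} X (Y^{*} A^{\dagger} X)^{\dagger} Y^{*} A^{\dagger}.$$ Put $\hat{\mathcal X}=\ker(M)$ and $\hat{\mathcal Y}=\operatorname{im}(M)^{\perp}$, and let $\hat X,\hat Y$ be matrices with $\operatorname{im}(\hat X)=\hat{\mathcal X}$ and $\operatorname{im}(\hat Y)=\hat{\mathcal Y}$. Suppose $\operatorname{ind}(M)=1$. Define $$N = P_{\hat{\mathcal X},\hat{\mathcal Y}^{\perp}}+A\,P_{\hat{\mathcal Y}^{\perp},\hat{\mathcal X}}.$$ Then $N$ is non-singular and $$M=P_{\hat{\mathcal Y}^{\perp},\hat{\mathcal X}}\,N^{-1}.$$ Also, $P_{\hat{\mathcal Y}^{\perp},\hat{\mathcal X}}$ can be expressed by $$P_{\hat{\mathcal Y}^{\perp},\hat{\mathcal X}}=I-\hat X(\hat Y^{*}\hat X)^{\dagger}\hat Y^{*}.$$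
   Context: $(\cdot)^{\dagger}$ is the Moore-Penrose pseudo-inverse, $(\cdot)^{*}$ the conjugate transpose, $(\cdot)^{\perp}$ the orthogonal complement. The index of a square matrix $M$ is $\operatorname{ind}(M)=\min\{k\ge 1 : \operatorname{rank}(M^{k+1})=\operatorname{rank}(M^{k})\}$. For complementary subspaces $\mathcal R,\mathcal N$ of $\mathbb C^n$, $P_{\mathcal R,\mathcal N}$ denotes the (oblique) projector with image $\mathcal R$ and kernel $\mathcal N$. When $\operatorname{ind}(M)=1$, the subspaces $\hat{\mathcal Y}^{\perp}=\operatorname{im}(M)$ and $\hat{\mathcal X}=\ker(M)$ are complementary, so the projectors in the statement are defined. *)

theory Defs
  imports "HOL-Analysis.Analysis"
begin

definition ctranspose :: "complex^'n^'m \<Rightarrow> complex^'m^'n" where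
  "ctranspose A = (\<chi> i j. cnj (A $ j $ i))"

text \<open>The Moore-Penrose pseudo-inverse, characterised by the four Penrose conditions
  (which have exactly one solution for every complex matrix).\<close>

definition is_pinv :: "complex^'n^'m \<Rightarrow> complex^'m^'n \<Rightarrow> bool" where
  "is_pinv A B \<longleftrightarrow> A ** B ** A = A \<and> B ** A ** B = B \<and>
     ctranspose (A ** B) = A ** B \<and> ctranspose (B ** A) = B ** A"

definition pinv :: "complex^'n^'m \<Rightarrow> complex^'m^'n" where
  "pinv A = (THE B. is_pinv A B)"

definition mat_im :: "complex^'n^'m \<Rightarrow> (complex^'m) set" where
  "mat_im A = range (\<lambda>v. A *v v)"

definition mat_ker :: "complex^'n^'m \<Rightarrow> (complex^'n) set" where
  "mat_ker A = {v. A *v v = 0}"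

text \<open>The library's \<^const>\<open>orthogonal_comp\<close> refers to the real inner product (the real part of
  the Hermitian one), hence the separate notion for the Hermitian inner product.\<close>

definition orth_compl :: "(complex^'n) set \<Rightarrow> (complex^'n) set" where
  "orth_compl S = {x. \<forall>y\<in>S. (\<Sum>i\<in>UNIV. cnj (y $ i) * x $ i) = 0}"

text \<open>The power operator of \<^typ>\<open>complex^'n^'n\<close> provided by the type classes is componentwise,
  hence an explicit power with respect to the matrix product.\<close>

primrec matpow :: "complex^'n^'n \<Rightarrow> nat \<Rightarrow> complex^'n^'n" where
  "matpow M 0 = mat 1"
| "matpow M (Suc k) = M ** matpow M k"

definition mat_index :: "complex^'n^'n \<Rightarrow> nat" where
  "mat_index M = (LEAST k. 1 \<le> k \<and> rank (matpow M (k + 1)) = rank (matpow M k))"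

text \<open>The projector with image \<open>R\<close> and kernel \<open>K\<close>; it exists and is unique when \<open>R\<close> and \<open>K\<close> are
  complementary subspaces, and is only meaningful in that case.\<close>

definition oblique_proj :: "(complex^'n) set \<Rightarrow> (complex^'n) set \<Rightarrow> complex^'n^'n" where
  "oblique_proj R K = (THE P. P ** P = P \<and> mat_im P = R \<and> mat_ker P = K)"

end

(* M is an outer inverse of A, that is MAM = M. Index 1 makes the ranges of M and M^2 coincide as
   well as their kernels, so M = M^2 C = D M^2, and P = MC = DM is the projector onto im M along
   ker M. From MAM = M it follows that MN = P, whence N is injective. For the last formula,
   Xh (Yh* Xh)^+ Yh* vanishes on im M = ker Yh* and is the identity on ker M = im Xh. *)
theory Submission
  imports Defs
begin

section \<open>Inner inverses and factorisation over a field\<close>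

lemma matrix_diff_ldistrib:
  fixes A :: "'a::ring_1^'n^'m"
  shows "A ** (B - C) = A ** B - A ** C"
  by (vector matrix_matrix_mult_def sum_subtractf right_diff_distrib)

lemma matrix_diff_rdistrib:
  fixes A :: "'a::ring_1^'n^'m"
  shows "(A - B) ** C = A ** C - B ** C"
  by (vector matrix_matrix_mult_def sum_subtractf left_diff_distrib)

text \<open>The matrix of a linear right inverse of \<open>A\<close> on its range serves as
  \<open>G\<close>. The pseudo-inverse is later built from such a \<open>G\<close>.\<close>

lemma matrix_inner_inverse_exists:
  fixes A :: "'a::field^'n^'m"
  shows "\<exists>G. A ** G ** A = A"
proof -
  obtain g where g: "Vector_Spaces.linear (*s) (*s) g" "\<forall>v\<in>range ((*v) A). A *v g v = v"
    using vec.linear_exists_right_inverse_on[OF matrix_vector_mul_linear_gen vec.subspace_UNIV]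
    by blast
  have "A ** matrix g ** A = A"
    unfolding matrix_eq by (simp add: g matrix_works flip: matrix_vector_mul_assoc)
  then show ?thesis by blast
qed

text \<open>For an inner inverse \<open>G\<close> of \<open>B\<close>, the product
  \<open>B ** G\<close> fixes the range of \<open>B\<close> pointwise, so \<open>C = G ** A\<close>
  works.\<close>

lemma range_subset_imp_right_factor:
  fixes A :: "'a::field^'n^'m" and B :: "'a^'k^'m"
  assumes "range ((*v) A) \<subseteq> range ((*v) B)"
  shows "\<exists>C. A = B ** C"
proof -
  obtain G where G: "B ** G ** B = B"
    using matrix_inner_inverse_exists by blast
  have "A *v x = (B ** (G ** A)) *v x" for x
  proof -
    obtain y where "A *v x = B *v y"
      using assms by blast
    then show ?thesis
      by (metis G matrix_mul_assoc matrix_vector_mul_assoc)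
  qed
  then show ?thesis
    unfolding matrix_eq by blast
qed

subsection \<open>Rank and matrices of index one\<close>

text \<open>\<open>rank\<close> unfolds to the row rank, and the rows of \<open>A\<close> are the
  columns of its transpose.\<close>

lemma rank_eq_dim_range_transpose:
  fixes A :: "'a::field^'n^'m"
  shows "rank A = vec.dim (range ((*v) (transpose A)))"
proof -
  have "column i (transpose A) = transpose A *v axis i 1" for i
    by (simp add: vec_eq_iff column_def matrix_vector_mult_def axis_def if_distrib cong: if_cong)
  then have "columns (transpose A) \<subseteq> range ((*v) (transpose A))"
    by (auto simp: columns_def)
  moreover have "vec.subspace (range ((*v) (transpose A)))"
    using vec.subspace_image[OF vec.subspace_UNIV] .
  ultimately have "vec.span (columns (transpose A)) \<subseteq> range ((*v) (transpose A))"
    by (rule vec.span_minimal)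
  then have "vec.span (columns (transpose A)) = range ((*v) (transpose A))"
    using matrix_vector_mult_in_columnspace_gen by blast
  then show ?thesis
    unfolding row_rank_def_gen by (metis columns_transpose vec.dim_span)
qed

lemma rank_matrix_mult_le_right:
  fixes A :: "'a::field^'n^'m" and B :: "'a^'p^'n"
  shows "rank (A ** B) \<le> rank B"
  unfolding rank_eq_dim_range_transpose matrix_transpose_mul
  by (rule vec.dim_subset) (auto simp flip: matrix_vector_mul_assoc)

text \<open>Without such a \<open>k\<close> the ranks of the powers would decrease strictly forever.
  Existence makes \<open>LEAST\<close> attained, so that \<open>mat_index M = 1\<close> yields a
  rank equation.\<close>

lemma mat_index_exists:
  "\<exists>k. 1 \<le> k \<and> rank (matpow M (k + 1)) = rank (matpow M k)"
proof (rule ccontr)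
  assume neg: "\<not> ?thesis"
  have dec: "rank (matpow M (Suc (Suc k))) < rank (matpow M (Suc k))" for k
  proof -
    have "rank (matpow M (Suc (Suc k))) \<noteq> rank (matpow M (Suc k))"
      using neg by (auto dest!: spec[of _ "Suc k"])
    then show ?thesis
      using rank_matrix_mult_le_right[of M "matpow M (Suc k)"] by simp
  qed
  have "rank (matpow M (Suc k)) + k \<le> rank (matpow M (Suc 0))" for k
  proof (induction k)
    case (Suc k)
    then show ?case using dec[of k] by linarith
  qed simp
  from this[of "Suc (rank (matpow M (Suc 0)))"] show False by simp
qed

lemma mat_index_one_rank:
  assumes "mat_index M = 1"
  shows "rank (M ** M) = rank M"
proof -
  have "rank (matpow M (mat_index M + 1)) = rank (matpow M (mat_index M))"
    unfolding mat_index_def using LeastI_ex[OF mat_index_exists] by blast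
  then show ?thesis using assms by simp
qed

text \<open>Equal row ranks make the row spaces of \<open>M ** M\<close> and \<open>M\<close>
  coincide, which gives \<open>D\<close>. Then \<open>D\<close> makes \<open>M\<close> injective on
  its own range, so the column spaces coincide as well, which gives \<open>C\<close>.\<close>

lemma rank_square_eq_imp_factors:
  fixes M :: "'a::field^'n^'n"
  assumes "rank (M ** M) = rank M"
  obtains C D where "M = M ** M ** C" "M = D ** M ** M"
proof -
  have sub: "vec.subspace (range ((*v) B))" for B :: "'a^'n^'n"
    using vec.subspace_image[OF vec.subspace_UNIV] .
  let ?T = "transpose M"
  have "range ((*v) (?T ** ?T)) = range ((*v) ?T)"
  proof (rule vec.subspace_dim_equal[OF sub sub])
    show "range ((*v) (?T ** ?T)) \<subseteq> range ((*v) ?T)"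
      by (auto simp flip: matrix_vector_mul_assoc)
  qed (use assms in \<open>simp add: rank_eq_dim_range_transpose matrix_transpose_mul\<close>)
  then obtain E where "?T = ?T ** ?T ** E"
    using range_subset_imp_right_factor by blast
  then have D: "M = transpose E ** M ** M"
    by (metis matrix_mul_assoc matrix_transpose_mul transpose_transpose)
  let ?R = "range ((*v) M)"
  have "inj_on ((*v) M) (vec.span ?R)"
  proof -
    have span: "vec.span ?R = ?R"
      using sub by (simp add: vec.span_eq_iff)
    have "M *v x = M *v y" if "M *v (M *v x) = M *v (M *v y)" for x y
      using that by (metis D matrix_vector_mul_assoc)
    then show ?thesis
      unfolding span by (auto simp: inj_on_def)
  qed
  then have "vec.dim ((*v) M ` ?R) = vec.dim ?R"
    by (rule vec.dim_image_eq[OF matrix_vector_mul_linear_gen])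
  moreover have "(*v) M ` ?R = range ((*v) (M ** M))"
    by (auto simp flip: matrix_vector_mul_assoc)
  ultimately have "range ((*v) (M ** M)) = ?R"
    by (intro vec.subspace_dim_equal[OF sub sub]) (auto simp flip: matrix_vector_mul_assoc)
  then obtain C where "M = M ** M ** C"
    using range_subset_imp_right_factor by blast
  with D that show thesis by blast
qed

subsection \<open>Conjugate transpose and pseudo-inverse\<close>

lemma ctranspose_ctranspose [simp]: "ctranspose (ctranspose A) = A"
  by (simp add: ctranspose_def vec_eq_iff)

lemma ctranspose_mult: "ctranspose (A ** B) = ctranspose B ** ctranspose A"
  by (simp add: ctranspose_def matrix_matrix_mult_def vec_eq_iff mult.commute)

lemma cnj_mult_sum_eq_0_iff:
  fixes x :: "complex^'n"
  shows "(\<Sum>i\<in>UNIV. cnj (x $ i) * x $ i) = 0 \<longleftrightarrow> x = 0"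
proof
  assume "(\<Sum>i\<in>UNIV. cnj (x $ i) * x $ i) = 0"
  then have "complex_of_real (\<Sum>i\<in>UNIV. (cmod (x $ i))\<^sup>2) = 0"
    unfolding of_real_sum complex_norm_square by (simp add: mult.commute)
  then have "(\<Sum>i\<in>UNIV. (cmod (x $ i))\<^sup>2) = 0"
    using of_real_eq_0_iff by blast
  then show "x = 0"
    by (simp add: sum_nonneg_eq_0_iff vec_eq_iff)
qed simp

text \<open>The diagonal entries of the product are the squared norms of the columns of
  \<open>Z\<close>.\<close>

lemma ctranspose_mult_self_eq_0:
  assumes "ctranspose Z ** Z = 0"
  shows "Z = 0"
proof -
  have "column j Z = 0" for j
  proof -
    have "(\<Sum>i\<in>UNIV. cnj (column j Z $ i) * column j Z $ i) = (ctranspose Z ** Z) $ j $ j"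
      by (simp add: ctranspose_def matrix_matrix_mult_def column_def)
    then show ?thesis
      using assms by (simp add: cnj_mult_sum_eq_0_iff)
  qed
  then show ?thesis
    by (simp add: vec_eq_iff column_def)
qed

text \<open>If \<open>G\<close> is an inner inverse of \<open>A\<^sup>*A\<close>, then \<open>A G A\<^sup>*\<close> is the orthogonal projector onto the
  range of \<open>A\<close>.\<close>

lemma hermitian_inner_inverse_exists:
  fixes A :: "complex^'n^'m"
  shows "\<exists>B. A ** B ** A = A \<and> ctranspose (A ** B) = A ** B"
proof -
  let ?S = "ctranspose A"
  obtain G where G: "(?S ** A) ** G ** (?S ** A) = ?S ** A"
    using matrix_inner_inverse_exists by blast
  let ?Z = "A ** G ** ?S ** A - A"
  have "?S ** ?Z = 0"
    using G by (simp add: matrix_diff_ldistrib matrix_mul_assoc)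
  \<comment> \<open>As \<open>?Z\<close> has the left factor \<open>A\<close>, its adjoint has the
    right factor \<open>?S\<close>, which annihilates \<open>?Z\<close>.\<close>
  then have "ctranspose (G ** ?S ** A - mat 1) ** (?S ** ?Z) = 0"
    by simp
  moreover have "?Z = A ** (G ** ?S ** A - mat 1)"
    by (simp add: matrix_diff_ldistrib matrix_mul_assoc)
  ultimately have "ctranspose ?Z ** ?Z = 0"
    by (metis ctranspose_mult matrix_mul_assoc)
  then have E: "A ** G ** ?S ** A = A"
    using ctranspose_mult_self_eq_0 by fastforce
  let ?E = "A ** G ** ?S"
  \<comment> \<open>\<open>G\<close> need not be hermitian. The product of \<open>?E\<close> with
    its adjoint is, and it equals that adjoint because \<open>?E ** A = A\<close>.\<close>
  have "?E ** ctranspose ?E = ?E ** A ** ctranspose G ** ?S"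
    by (simp add: ctranspose_mult matrix_mul_assoc)
  also have "\<dots> = ctranspose ?E"
    using E by (simp add: ctranspose_mult matrix_mul_assoc)
  finally have "ctranspose ?E = ?E"
    by (metis ctranspose_ctranspose ctranspose_mult)
  with E show ?thesis
    by (intro exI[of _ "G ** ?S"]) (simp add: matrix_mul_assoc)
qed

text \<open>One inner inverse \<open>B\<close> makes \<open>A ** B\<close> hermitian; the same
  result for \<open>ctranspose A\<close> yields an inner inverse \<open>C\<close> with
  \<open>C ** A\<close> hermitian. The product \<open>C ** A ** B\<close> inherits both
  symmetries.\<close>

lemma is_pinv_exists:
  fixes A :: "complex^'n^'m"
  shows "\<exists>B. is_pinv A B"
proof -
  obtain B where B: "A ** B ** A = A" "ctranspose (A ** B) = A ** B"
    using hermitian_inner_inverse_exists by blast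
  obtain C' where C': "ctranspose A ** C' ** ctranspose A = ctranspose A"
    "ctranspose (ctranspose A ** C') = ctranspose A ** C'"
    using hermitian_inner_inverse_exists by blast
  define C where "C = ctranspose C'"
  have C: "A ** C ** A = A" "ctranspose (C ** A) = C ** A"
    using arg_cong[OF C'(1), of ctranspose] C'(2)
    by (simp_all add: C_def ctranspose_mult matrix_mul_assoc)
  let ?P = "C ** A ** B"
  have "A ** ?P = A ** B" "?P ** A = C ** A"
    using B(1) C(1) by (metis matrix_mul_assoc)+
  then show ?thesis
    unfolding is_pinv_def using B C
    by (intro exI[of _ ?P]) (metis matrix_mul_assoc)
qed

text \<open>\<open>A ** B\<close> and \<open>A ** C\<close> are hermitian and absorb each other, so
  taking adjoints identifies them; likewise \<open>B ** A\<close> and \<open>C ** A\<close>. Then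
  \<open>B ** A ** B\<close> turns into \<open>C ** A ** C\<close>.\<close>

lemma is_pinv_unique:
  assumes "is_pinv A B" "is_pinv A C"
  shows "B = C"
proof -
  note B = assms(1)[unfolded is_pinv_def] and C = assms(2)[unfolded is_pinv_def]
  have "A ** B = ctranspose (A ** C ** A ** B)"
    using B C by metis
  also have "\<dots> = ctranspose (A ** B) ** ctranspose (A ** C)"
    by (metis ctranspose_mult matrix_mul_assoc)
  also have "\<dots> = A ** C"
    using B C by (metis matrix_mul_assoc)
  finally have AB: "A ** B = A ** C" .
  have "B ** A = ctranspose (B ** A ** C ** A)"
    using B C by (metis matrix_mul_assoc)
  also have "\<dots> = ctranspose (C ** A) ** ctranspose (B ** A)"
    by (metis ctranspose_mult matrix_mul_assoc)
  also have "\<dots> = C ** A"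
    using B C by (metis matrix_mul_assoc)
  finally have BA: "B ** A = C ** A" .
  have "B = B ** (A ** B)"
    using B by (simp add: matrix_mul_assoc)
  also have "\<dots> = C ** A ** C"
    by (metis AB BA matrix_mul_assoc)
  finally show ?thesis
    using C by simp
qed

lemma is_pinv_pinv: "is_pinv A (pinv A)"
  unfolding pinv_def
  by (rule theI') (use is_pinv_exists is_pinv_unique in blast)

lemma mult_pinv_mult: "A ** pinv A ** A = A"
  and pinv_mult_pinv: "pinv A ** A ** pinv A = pinv A"
  and ctranspose_mult_pinv: "ctranspose (A ** pinv A) = A ** pinv A"
  using is_pinv_pinv[of A] unfolding is_pinv_def by blast+

section \<open>Hermitian orthogonal complements of images\<close>

lemma orth_compl_mat_im: "orth_compl (mat_im B) = mat_ker (ctranspose B)"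
proof -
  have adj: "(\<Sum>i\<in>UNIV. cnj ((B *v v) $ i) * x $ i)
      = (\<Sum>j\<in>UNIV. cnj (v $ j) * (ctranspose B *v x) $ j)" for v x
    unfolding matrix_vector_mult_def ctranspose_def
    by (simp add: sum_distrib_left sum_distrib_right) (subst sum.swap, simp add: ac_simps)
  \<comment> \<open>Taking \<open>v\<close> to be \<open>ctranspose B *v x\<close> itself turns the
    sum into a squared norm.\<close>
  have "ctranspose B *v x = 0"
    if "\<forall>v. (\<Sum>j\<in>UNIV. cnj (v $ j) * (ctranspose B *v x) $ j) = 0" for x
    using that cnj_mult_sum_eq_0_iff by blast
  then show ?thesis
    by (auto simp: orth_compl_def mat_im_def mat_ker_def adj)
qed

text \<open>For the harder inclusion, \<open>B ** pinv B\<close> is the orthogonal projector onto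
  the image. The residual \<open>y\<close> of \<open>x\<close> is orthogonal both to
  \<open>x\<close> and to its projection, hence to itself.\<close>

lemma orth_compl_orth_compl_mat_im: "orth_compl (orth_compl (mat_im B)) = mat_im B"
proof
  show "mat_im B \<subseteq> orth_compl (orth_compl (mat_im B))"
  proof
    fix x
    assume x: "x \<in> mat_im B"
    have "(\<Sum>i\<in>UNIV. cnj (y $ i) * x $ i) = 0" if "y \<in> orth_compl (mat_im B)" for y
    proof -
      have "(\<Sum>i\<in>UNIV. cnj (y $ i) * x $ i) = cnj (\<Sum>i\<in>UNIV. cnj (x $ i) * y $ i)"
        by (simp add: mult.commute)
      then show ?thesis
        using that x by (simp only: orth_compl_def) simp
    qed
    then show "x \<in> orth_compl (orth_compl (mat_im B))"
      by (simp add: orth_compl_def)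
  qed
  then have sup: "\<And>z. z \<in> mat_im B \<Longrightarrow> z \<in> orth_compl (orth_compl (mat_im B))"
    by blast
  show "orth_compl (orth_compl (mat_im B)) \<subseteq> mat_im B"
  proof
    fix x
    assume x: "x \<in> orth_compl (orth_compl (mat_im B))"
    let ?E = "B ** pinv B"
    define y where "y = x - ?E *v x"
    have "ctranspose B ** ?E = ctranspose B"
      by (metis ctranspose_mult ctranspose_mult_pinv mult_pinv_mult)
    then have y: "y \<in> orth_compl (mat_im B)"
      by (simp add: y_def orth_compl_mat_im mat_ker_def matrix_vector_mult_diff_distrib
          matrix_vector_mul_assoc)
    have "?E *v x \<in> mat_im B"
      by (auto simp: mat_im_def simp flip: matrix_vector_mul_assoc)
    then have "(\<Sum>i\<in>UNIV. cnj (y $ i) * (?E *v x) $ i) = 0"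
      using sup y by (simp add: orth_compl_def)
    moreover have "(\<Sum>i\<in>UNIV. cnj (y $ i) * x $ i) = 0"
      using x y by (simp add: orth_compl_def)
    ultimately have "(\<Sum>i\<in>UNIV. cnj (y $ i) * y $ i) = 0"
      by (simp add: y_def right_diff_distrib sum_subtractf)
    then have "y = 0"
      by (simp only: cnj_mult_sum_eq_0_iff)
    then have "x = ?E *v x"
      by (simp add: y_def)
    then show "x \<in> mat_im B"
      unfolding mat_im_def by (metis matrix_vector_mul_assoc rangeI)
  qed
qed

subsection \<open>Oblique projectors\<close>

lemma idempotent_fixes_mat_im:
  assumes "P ** P = P" "x \<in> mat_im P"
  shows "P *v x = x"
  using assms by (auto simp: mat_im_def matrix_vector_mul_assoc)

text \<open>Two idempotents with the same image and kernel agree on both summands of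
  \<open>x = P *v x + (x - P *v x)\<close>.\<close>

lemma oblique_proj_eqI:
  assumes "P ** P = P" "mat_im P = R" "mat_ker P = K"
  shows "oblique_proj R K = P"
  unfolding oblique_proj_def
proof (rule the_equality)
  fix Q :: "complex^'a^'a"
  assume Q: "Q ** Q = Q \<and> mat_im Q = R \<and> mat_ker Q = K"
  have "Q *v x = P *v x" for x
  proof -
    have "x - P *v x \<in> mat_ker P"
      using assms(1) by (simp add: mat_ker_def matrix_vector_mult_diff_distrib matrix_vector_mul_assoc)
    then have "Q *v (x - P *v x) = 0"
      using Q assms by (simp add: mat_ker_def set_eq_iff)
    moreover have "Q *v (P *v x) = P *v x"
      using Q assms idempotent_fixes_mat_im[of Q "P *v x"] by (auto simp: mat_im_def)
    ultimately show ?thesis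
      by (simp add: matrix_vector_mult_diff_distrib)
  qed
  then show "Q = P"
    by (simp add: matrix_eq)
qed (use assms in blast)

lemma idempotent_complement:
  fixes P :: "complex^'n^'n"
  assumes P: "P ** P = P"
  shows "(mat 1 - P) ** (mat 1 - P) = mat 1 - P"
    and "mat_im (mat 1 - P) = mat_ker P"
    and "mat_ker (mat 1 - P) = mat_im P"
proof -
  show "(mat 1 - P) ** (mat 1 - P) = mat 1 - P"
    by (simp add: matrix_diff_ldistrib matrix_diff_rdistrib P)
  have "x = (mat 1 - P) *v x" if "P *v x = 0" for x
    using that by (simp add: matrix_vector_mult_diff_rdistrib)
  moreover have "P *v ((mat 1 - P) *v x) = 0" for x
    by (simp add: matrix_vector_mul_assoc matrix_diff_ldistrib P)
  ultimately show "mat_im (mat 1 - P) = mat_ker P"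
    by (auto simp: mat_im_def mat_ker_def)
  show "mat_ker (mat 1 - P) = mat_im P"
  proof
    show "mat_ker (mat 1 - P) \<subseteq> mat_im P"
      by (auto simp: mat_ker_def mat_im_def matrix_vector_mult_diff_rdistrib)
    show "mat_im P \<subseteq> mat_ker (mat 1 - P)"
      using idempotent_fixes_mat_im[OF P]
      by (simp add: mat_ker_def matrix_vector_mult_diff_rdistrib subset_iff)
  qed
qed

text \<open>The form \<open>M ** C\<close> bounds the image from above, the form
  \<open>D ** M\<close> bounds the kernel from below. The reverse inclusions come from
  \<open>M ** C ** M = M\<close> and \<open>M ** (M ** C) = M\<close>.\<close>

lemma square_factors_imp_projector:
  fixes M :: "complex^'n^'n"
  assumes M: "M = M ** M ** C" "M = D ** M ** M"
  shows "(M ** C) ** (M ** C) = M ** C"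
    and "mat_im (M ** C) = mat_im M"
    and "mat_ker (M ** C) = mat_ker M"
    and "M ** (M ** C) = M"
proof -
  \<comment> \<open>Both sides equal \<open>D ** M ** M ** C\<close>.\<close>
  have DM: "M ** C = D ** M"
    by (metis M matrix_mul_assoc)
  show MP: "M ** (M ** C) = M"
    using M(1) by (simp add: matrix_mul_assoc)
  have PM: "M ** C ** M = M"
    using M(2) by (simp add: DM)
  show "(M ** C) ** (M ** C) = M ** C"
    by (metis PM matrix_mul_assoc)
  have "M *v x = M ** C *v (M *v x)" for x
    by (simp add: matrix_vector_mul_assoc PM)
  then show "mat_im (M ** C) = mat_im M"
    by (auto simp: mat_im_def simp flip: matrix_vector_mul_assoc)
  show "mat_ker (M ** C) = mat_ker M"
  proof
    show "mat_ker (M ** C) \<subseteq> mat_ker M"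
      unfolding mat_ker_def
      by (metis (mono_tags) Collect_mono MP matrix_vector_mul_assoc matrix_vector_mult_0_right)
    show "mat_ker M \<subseteq> mat_ker (M ** C)"
      unfolding DM by (auto simp: mat_ker_def simp flip: matrix_vector_mul_assoc)
  qed
qed

lemma idempotent_eq_pinv_formula:
  fixes P :: "complex^'n^'n" and X :: "complex^'r^'n" and Y :: "complex^'s^'n"
  assumes P: "P ** P = P" and X: "mat_im X = mat_ker P" and Y: "mat_ker (ctranspose Y) = mat_im P"
  shows "P = mat 1 - X ** pinv (ctranspose Y ** X) ** ctranspose Y"
proof -
  let ?T = "ctranspose Y ** X" and ?Y = "ctranspose Y"
  let ?Q = "X ** pinv ?T ** ?Y"
  have PX: "P ** X = 0"
    using X by (auto simp: matrix_eq mat_im_def mat_ker_def simp flip: matrix_vector_mul_assoc)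
  have YP: "?Y ** P = 0"
    using Y by (auto simp: matrix_eq mat_im_def mat_ker_def simp flip: matrix_vector_mul_assoc)
  have QX: "?Q ** X = X"
  proof -
    \<comment> \<open>This is the first Penrose condition for \<open>?T\<close>. It puts the columns
      of \<open>?Q ** X - X\<close> into the image of \<open>P\<close>, while the left factor
      \<open>X\<close> puts them into its kernel, so they vanish.\<close>
    have "?Y ** (?Q ** X - X) = 0"
      using mult_pinv_mult[of ?T] by (simp add: matrix_diff_ldistrib matrix_mul_assoc)
    then have "P *v ((?Q ** X - X) *v v) = (?Q ** X - X) *v v" for v
      by (intro idempotent_fixes_mat_im[OF P])
        (simp add: mat_ker_def matrix_vector_mul_assoc flip: Y)
    then have "P ** (?Q ** X - X) = ?Q ** X - X"
      by (simp add: matrix_eq matrix_vector_mul_assoc)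
    then show ?thesis
      using PX by (simp add: matrix_diff_ldistrib matrix_mul_assoc)
  qed
  have "?Q *v x = (mat 1 - P) *v x" for x
  proof -
    have "(mat 1 - P) *v x \<in> mat_im X"
      using X idempotent_complement(2)[OF P] by (auto simp: mat_im_def)
    then obtain v where "(mat 1 - P) *v x = X *v v"
      by (auto simp: mat_im_def)
    then have "?Q *v ((mat 1 - P) *v x) = (mat 1 - P) *v x"
      by (metis QX matrix_vector_mul_assoc)
    moreover have "?Q ** P = 0"
      using YP by (simp flip: matrix_mul_assoc)
    ultimately show ?thesis
      by (simp add: matrix_vector_mul_assoc matrix_diff_ldistrib)
  qed
  then have "?Q = mat 1 - P"
    by (simp add: matrix_eq)
  then show ?thesis by simp
qed

text \<open>With \<open>?L\<close> the subtracted term, expanding gives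
  \<open>?G - ?L - ?L + ?L\<close>: the mixed products reduce to \<open>?L\<close> by the second
  Penrose condition for \<open>?G\<close>, and \<open>?L ** A ** ?L\<close> reduces to
  \<open>?L\<close> by the one for \<open>?K\<close>.\<close>

lemma pinv_correction_outer_inverse:
  fixes A :: "complex^'n^'m" and X :: "complex^'p^'m" and Y :: "complex^'q^'n"
  defines "M \<equiv> pinv A - pinv A ** X ** pinv (ctranspose Y ** pinv A ** X) ** ctranspose Y ** pinv A"
  shows "M ** A ** M = M"
proof -
  let ?G = "pinv A" and ?Y = "ctranspose Y"
  let ?K = "pinv (?Y ** ?G ** X)"
  let ?L = "?G ** X ** ?K ** ?Y ** ?G"
  have G: "?G ** A ** ?G = ?G"
    by (rule pinv_mult_pinv)
  have L1: "?L ** A ** ?G = ?L"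
    using G by (metis matrix_mul_assoc)
  have L2: "?G ** A ** ?L = ?L"
    using G by (simp add: matrix_mul_assoc)
  have "?L ** A ** ?L = (?L ** A ** ?G) ** X ** ?K ** ?Y ** ?G"
    by (simp add: matrix_mul_assoc)
  also have "\<dots> = ?G ** X ** (?K ** (?Y ** ?G ** X) ** ?K) ** ?Y ** ?G"
    unfolding L1 by (simp add: matrix_mul_assoc)
  also have "\<dots> = ?L"
    by (simp add: pinv_mult_pinv)
  finally have L3: "?L ** A ** ?L = ?L" .
  show ?thesis
    unfolding M_def by (simp add: matrix_diff_ldistrib matrix_diff_rdistrib G L1 L2 L3)
qed

lemma outer_inverse_eq_proj_mult_inv:
  fixes A M P N :: "complex^'n^'n"
  assumes outer: "M ** A ** M = M" and P: "P = M ** C" and MP: "M ** P = M"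
    and N: "N = (mat 1 - P) + A ** P"
  shows "invertible N \<and> M = P ** matrix_inv N"
proof -
  \<comment> \<open>\<open>M\<close> annihilates \<open>mat 1 - P\<close>, and
    \<open>M ** A ** P = M ** A ** M ** C = M ** C\<close>.\<close>
  have MN: "M ** N = P"
    unfolding N using outer MP
    by (simp add: P matrix_add_ldistrib matrix_diff_ldistrib matrix_mul_assoc)
  have "v = 0" if "N *v v = 0" for v
  proof -
    have "P *v v = M *v (N *v v)"
      by (simp add: matrix_vector_mul_assoc MN)
    then have "P *v v = 0"
      by (simp add: that)
    \<comment> \<open>Once \<open>P *v v = 0\<close>, the vector \<open>N *v v\<close> collapses to
      \<open>v\<close>.\<close>
    then show ?thesis
      using that by (simp add: N matrix_vector_mult_add_rdistrib matrix_vector_mult_diff_rdistrib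
          flip: matrix_vector_mul_assoc)
  qed
  then have inv: "invertible N"
    by (simp add: invertible_left_inverse matrix_left_invertible_ker)
  then have "N ** matrix_inv N = mat 1"
    by (metis (mono_tags, lifting) invertible_def matrix_inv_def someI_ex)
  then have "M = P ** matrix_inv N"
    by (metis MN matrix_mul_assoc matrix_mul_rid)
  with inv show ?thesis by blast
qed

theorem mainTheorem3:
  fixes A M N :: "complex^'n^'n"
    and X :: "complex^'p^'n" and Y :: "complex^'q^'n"
    and Xs Ys :: "(complex^'n) set"
    and Xh :: "complex^'r^'n" and Yh :: "complex^'s^'n"
  assumes M: "M = pinv A - pinv A ** X ** pinv (ctranspose Y ** pinv A ** X) ** ctranspose Y ** pinv A"
    and Xs: "Xs = mat_ker M"
    and Ys: "Ys = orth_compl (mat_im M)"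
    and Xh: "mat_im Xh = Xs"
    and Yh: "mat_im Yh = Ys"
    and ind: "mat_index M = 1"
    and N: "N = oblique_proj Xs (orth_compl Ys) + A ** oblique_proj (orth_compl Ys) Xs"
  shows "invertible N
    \<and> M = oblique_proj (orth_compl Ys) Xs ** matrix_inv N
    \<and> oblique_proj (orth_compl Ys) Xs = mat 1 - Xh ** pinv (ctranspose Yh ** Xh) ** ctranspose Yh"
proof -
  obtain C D where CD: "M = M ** M ** C" "M = D ** M ** M"
    using rank_square_eq_imp_factors[OF mat_index_one_rank[OF ind]] .
  define P where "P = M ** C"
  note P = square_factors_imp_projector[OF CD, folded P_def]
  note Q = idempotent_complement[OF P(1)]
  have im: "orth_compl Ys = mat_im M"
    by (simp add: Ys orth_compl_orth_compl_mat_im)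
  have proj: "oblique_proj (orth_compl Ys) Xs = P"
    using P by (intro oblique_proj_eqI) (simp_all add: im Xs)
  \<comment> \<open>Passing to the complementary idempotent swaps image and kernel.\<close>
  have "oblique_proj Xs (orth_compl Ys) = mat 1 - P"
    using P Q by (intro oblique_proj_eqI) (simp_all add: im Xs)
  then have "N = (mat 1 - P) + A ** P"
    by (simp add: N proj)
  moreover have "M ** A ** M = M"
    unfolding M by (rule pinv_correction_outer_inverse)
  ultimately have "invertible N \<and> M = P ** matrix_inv N"
    using outer_inverse_eq_proj_mult_inv P_def P(4) by blast
  \<comment> \<open>The kernel is the orthogonal complement of the image \<open>Ys\<close> of
    \<open>Yh\<close>, that is, the double complement of the image of \<open>M\<close>.\<close>
  moreover have "mat_ker (ctranspose Yh) = mat_im P"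
    using im by (simp add: P(2) Yh flip: orth_compl_mat_im)
  then have "P = mat 1 - Xh ** pinv (ctranspose Yh ** Xh) ** ctranspose Yh"
    using P by (intro idempotent_eq_pinv_formula) (simp_all add: Xh Xs)
  ultimately show ?thesis
    by (simp add: proj)
qed

end
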